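(* Let $R$ be a commutative ring with identity, $\mathcal{M}$ its space of minimal prime ideals, and $R_K(\mathcal{M})$ the ideal of all $a\in R$ for which $\overline{D(a)}$ is compact. (i) $R_K(\mathcal{M})$ is contained in the intersection of all strongly dense $fd$-ideals of $R$. (ii) $R_K(\mathcal{M})$ is an $sd$-ideal if and only if $\mathcal{M}$ is a locally compact non-compact space.
   Context: $\mathcal{M}$ is the set of minimal prime ideals of $R$ with the Zariski topology, whose base of open sets is $\{D(a): a\in R\}$, where $D(a)=\{P\in\mathcal{M}: a\notin P\}$; $\overline{D(a)}$ is the closure of $D(a)$ in $\mathcal{M}$, and compact means compact as a subspace of $\mathcal{M}$. For $S\subseteq R$, $\mathrm{ann}(S)=\{a\in R: aS=0\}$. An ideal $I$ is strongly dense (an $sd$-ideal) if every element of $I$ is a zero divisor of $R$ and $I$ is contained in no minimal prime ideal of $R$. An ideal $I$ is an $fd$-ideal if for each finite subset $F$ of $I$ and each $x\in R$, $\mathrm{ann}(F)\subseteq\mathrm{ann}(x)$ implies $x\in I$. A strongly dense $fd$-ideal is an ideal which is both. Locally compact means every point has a compact neighborhood.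
   Formalization: Part (i) is proved for reduced R (no nonzero nilpotents); it fails otherwise: in k[x,y]/(x²,xy) the ideal (x,y) is a strongly dense fd-ideal, but the space is one point, so R_K = R. Part (ii) is for all commutative R. *)

theory Defs
  imports "HOL-Algebra.Ideal" "HOL-Analysis.Analysis"
begin

definition minimal_primes :: "('a, 'b) ring_scheme \<Rightarrow> 'a set set" where
  "minimal_primes R =
     {P. primeideal P R \<and> (\<forall>Q. primeideal Q R \<and> Q \<subseteq> P \<longrightarrow> Q = P)}"

definition min_D :: "('a, 'b) ring_scheme \<Rightarrow> 'a \<Rightarrow> 'a set set" where
  "min_D R a = {P \<in> minimal_primes R. a \<notin> P}"

definition min_space :: "('a, 'b) ring_scheme \<Rightarrow> 'a set topology" where
  "min_space R = topology (arbitrary union_of (\<lambda>U. \<exists>a\<in>carrier R. U = min_D R a))"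

lemma (in cring) min_D_mult:
  assumes a: "a \<in> carrier R" and b: "b \<in> carrier R"
  shows "min_D R (a \<otimes> b) = min_D R a \<inter> min_D R b"
proof -
  have "a \<otimes> b \<in> P \<longleftrightarrow> a \<in> P \<or> b \<in> P" if "P \<in> minimal_primes R" for P
  proof -
    interpret primeideal P R
      using that by (simp add: minimal_primes_def)
    show ?thesis
      using I_prime[OF a b] I_l_closed[OF _ a] I_r_closed[OF _ b] by auto
  qed
  then show ?thesis
    by (auto simp: min_D_def)
qed

text \<open>The junk case of \<^term>\<open>topology\<close> does not arise:
  over a commutative ring the sets \<^term>\<open>min_D R a\<close> are indeed a base.\<close>

lemma (in cring) openin_min_space:
  "openin (min_space R) = arbitrary union_of (\<lambda>U. \<exists>a\<in>carrier R. U = min_D R a)"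
  unfolding min_space_def
proof (rule topology_inverse', rule istopology_base)
  fix S T
  assume "\<exists>a\<in>carrier R. S = min_D R a" "\<exists>a\<in>carrier R. T = min_D R a"
  then show "\<exists>a\<in>carrier R. S \<inter> T = min_D R a"
    using min_D_mult m_closed by metis
qed

lemma (in cring) topspace_min_space: "topspace (min_space R) = minimal_primes R"
proof -
  have "\<one> \<notin> P" if "P \<in> minimal_primes R" for P
  proof -
    interpret primeideal P R
      using that by (simp add: minimal_primes_def)
    show ?thesis
      using one_imp_carrier I_notcarr by auto
  qed
  then have D1: "min_D R \<one> = minimal_primes R"
    by (auto simp: min_D_def)
  have "openin (min_space R) (min_D R \<one>)"
    unfolding openin_min_space by (rule union_of_inc) (use one_closed in \<open>auto simp: arbitrary_def\<close>)
  moreover have "U \<subseteq> minimal_primes R" if "openin (min_space R) U" for U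
    using that unfolding openin_min_space by (auto simp: union_of_def min_D_def)
  ultimately show ?thesis
    unfolding D1 by (intro subset_antisym openin_subset) auto
qed

definition ann :: "('a, 'b) ring_scheme \<Rightarrow> 'a set \<Rightarrow> 'a set" where
  "ann R S = {a \<in> carrier R. \<forall>s\<in>S. a \<otimes>\<^bsub>R\<^esub> s = \<zero>\<^bsub>R\<^esub>}"

text \<open>Zero counts as a zero divisor of a nonzero ring.\<close>

definition zero_divisor :: "('a, 'b) ring_scheme \<Rightarrow> 'a \<Rightarrow> bool" where
  "zero_divisor R a \<longleftrightarrow>
     a \<in> carrier R \<and> (\<exists>b\<in>carrier R. b \<noteq> \<zero>\<^bsub>R\<^esub> \<and> a \<otimes>\<^bsub>R\<^esub> b = \<zero>\<^bsub>R\<^esub>)"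

definition sd_ideal :: "('a, 'b) ring_scheme \<Rightarrow> 'a set \<Rightarrow> bool" where
  "sd_ideal R I \<longleftrightarrow> ideal I R \<and> (\<forall>a\<in>I. zero_divisor R a) \<and>
     (\<forall>P\<in>minimal_primes R. \<not> I \<subseteq> P)"

definition fd_ideal :: "('a, 'b) ring_scheme \<Rightarrow> 'a set \<Rightarrow> bool" where
  "fd_ideal R I \<longleftrightarrow> ideal I R \<and>
     (\<forall>F x. finite F \<and> F \<subseteq> I \<and> x \<in> carrier R \<and> ann R F \<subseteq> ann R {x} \<longrightarrow> x \<in> I)"

definition R_K :: "('a, 'b) ring_scheme \<Rightarrow> 'a set" where
  "R_K R = {a \<in> carrier R. compactin (min_space R) (min_space R closure_of min_D R a)}"

definition reduced_ring :: "('a, 'b) ring_scheme \<Rightarrow> bool" where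
  "reduced_ring R \<longleftrightarrow>
     (\<forall>a\<in>carrier R. \<forall>n::nat. a [^]\<^bsub>R\<^esub> n = \<zero>\<^bsub>R\<^esub> \<longrightarrow> a = \<zero>\<^bsub>R\<^esub>)"

end

theory Submission
  imports Defs
begin

text \<open>
  Everything rests on one algebraic fact: an element \<open>a\<close> of a minimal prime \<open>P\<close> satisfies
  \<open>s a^n = 0\<close> for some \<open>s \<notin> P\<close> and some \<open>n\<close> (\<open>minimal_prime_annihilator\<close>).  It
  holds because minimal primes are exactly the complements of the multiplicative sets that are
  maximal among those avoiding \<open>0\<close>: if \<open>a\<close> is outside such a maximal set \<open>S\<close>,
  the products \<open>s a^n\<close> form a strictly larger multiplicative set, which must contain \<open>0\<close>.

  The fact has two consequences.  Topologically, \<open>D(s)\<close> is a neighbourhood of \<open>P\<close> disjoint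
  from \<open>D(a)\<close>, so each \<open>D(a)\<close> is clopen, and \<open>R_K\<close> consists of the \<open>a\<close> with
  \<open>D(a)\<close> itself compact.  Algebraically, every element of a minimal prime is a zero divisor.

  For the first claim, let \<open>I\<close> be strongly dense and \<open>a \<in> R_K\<close>.  The sets \<open>D(b)\<close>,
  \<open>b \<in> I\<close>, cover the whole space, so finitely many of them, indexed by \<open>F \<subseteq> I\<close>, cover
  \<open>D(a)\<close>.  If \<open>c\<close> annihilates \<open>F\<close> then \<open>c a\<close> lies in every minimal prime, and in a
  reduced ring this forces \<open>c a = 0\<close>; hence \<open>ann F \<subseteq> ann a\<close>, and the \<open>fd\<close>
  property puts \<open>a\<close> in \<open>I\<close>.

  For the second, since the base sets are clopen, local compactness says that every point lies in some
  compact \<open>D(a)\<close>, that is, that no minimal prime contains \<open>R_K\<close>.  Non-compactness of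
  the space says that \<open>1 \<notin> R_K\<close>; then no \<open>D(a)\<close> with \<open>a \<in> R_K\<close> is the whole
  space, so \<open>a\<close> lies in some minimal prime and is a zero divisor.  Conversely, if
  \<open>R_K\<close> consists of zero divisors, it cannot contain \<open>1\<close>.
\<close>

section \<open>Minimal primes and maximal multiplicative sets\<close>

definition zero_free_submonoid :: "('a, 'b) ring_scheme \<Rightarrow> 'a set \<Rightarrow> bool" where
  "zero_free_submonoid R S \<longleftrightarrow> submonoid S R \<and> \<zero>\<^bsub>R\<^esub> \<notin> S"

definition maximal_zero_free_submonoid :: "('a, 'b) ring_scheme \<Rightarrow> 'a set \<Rightarrow> bool" where
  "maximal_zero_free_submonoid R S \<longleftrightarrow> zero_free_submonoid R S \<and>
     (\<forall>T. zero_free_submonoid R T \<and> S \<subseteq> T \<longrightarrow> T = S)"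

context cring
begin

text \<open>The binomial theorem would give this at once, each term of the expansion containing
  \<open>a^n\<close> or \<open>b^m\<close>.  Induction on the total exponent avoids the expansion: peel off one
  factor \<open>a + b\<close> and absorb \<open>a\<close> or \<open>b\<close> into \<open>u\<close>.\<close>

lemma annihilates_power_add:
  fixes n m :: nat
  assumes "u \<in> carrier R" "a \<in> carrier R" "b \<in> carrier R"
    and "u \<otimes> a [^] n = \<zero>" "u \<otimes> b [^] m = \<zero>"
  shows "u \<otimes> (a \<oplus> b) [^] (n + m) = \<zero>"
  using assms
proof (induction "n + m" arbitrary: n m u)
  case 0
  then show ?case by simp
next
  case (Suc k)
  note carr = Suc.prems(1-3)
  show ?case
  proof (cases "n = 0 \<or> m = 0")
    case True
    then have "u = \<zero>" using Suc.prems by auto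
    then show ?thesis using carr by simp
  next
    case False
    then obtain n' m' where nm: "n = Suc n'" "m = Suc m'"
      by (metis not0_implies_Suc)
    have a_pow: "(u \<otimes> a) \<otimes> a [^] n' = \<zero>" and b_pow: "(u \<otimes> b) \<otimes> b [^] m' = \<zero>"
      using Suc.prems nm carr by (simp_all add: m_ac)
    have "(u \<otimes> a) \<otimes> b [^] m = a \<otimes> (u \<otimes> b [^] m)"
      and "(u \<otimes> b) \<otimes> a [^] n = b \<otimes> (u \<otimes> a [^] n)"
      using carr by (simp_all add: m_ac)
    then have b_kills: "(u \<otimes> a) \<otimes> b [^] m = \<zero>" and a_kills: "(u \<otimes> b) \<otimes> a [^] n = \<zero>"
      using Suc.prems by simp_all
    have k: "k = n' + m" "k = n + m'" "n + m = Suc k"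
      using Suc.hyps(2) nm by auto
    have "(u \<otimes> a) \<otimes> (a \<oplus> b) [^] k = \<zero>"
      unfolding k(1) by (rule Suc.hyps(1)) (use k carr a_pow b_kills in auto)
    moreover have "(u \<otimes> b) \<otimes> (a \<oplus> b) [^] k = \<zero>"
      unfolding k(2) by (rule Suc.hyps(1)) (use k carr b_pow a_kills in auto)
    moreover have "u \<otimes> (a \<oplus> b) [^] Suc k
        = (u \<otimes> a) \<otimes> (a \<oplus> b) [^] k \<oplus> (u \<otimes> b) \<otimes> (a \<oplus> b) [^] k"
    proof -
      have "u \<otimes> (a \<oplus> b) [^] Suc k = (u \<otimes> (a \<oplus> b)) \<otimes> (a \<oplus> b) [^] k"
        using carr by (simp add: m_ac)
      also have "\<dots> = (u \<otimes> a \<oplus> u \<otimes> b) \<otimes> (a \<oplus> b) [^] k"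
        using carr by (simp add: r_distr)
      finally show ?thesis using carr by (simp add: l_distr)
    qed
    ultimately show ?thesis
      unfolding k(3) by simp
  qed
qed

lemma submonoid_adjoin_powers:
  assumes "submonoid S R" and a: "a \<in> carrier R"
  shows "submonoid {s \<otimes> a [^] n | s (n::nat). s \<in> S} R"
proof -
  interpret S: submonoid S R by fact
  show ?thesis
  proof
    show "{s \<otimes> a [^] n | s (n::nat). s \<in> S} \<subseteq> carrier R"
      using S.subset a by auto
    show "\<one> \<in> {s \<otimes> a [^] n | s (n::nat). s \<in> S}"
      using S.one_closed a by (auto intro!: exI[of _ \<one>] exI[of _ "0::nat"])
  next
    fix x y
    assume "x \<in> {s \<otimes> a [^] n | s (n::nat). s \<in> S}" "y \<in> {s \<otimes> a [^] n | s (n::nat). s \<in> S}"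
    then obtain s t and n m :: nat
      where xy: "x = s \<otimes> a [^] n" "y = t \<otimes> a [^] m" and st: "s \<in> S" "t \<in> S"
      by auto
    have carr: "s \<in> carrier R" "t \<in> carrier R"
      using st S.subset by auto
    have "x \<otimes> y = (s \<otimes> t) \<otimes> (a [^] n \<otimes> a [^] m)"
      using xy carr a by (simp add: m_ac)
    also have "\<dots> = (s \<otimes> t) \<otimes> a [^] (n + m)"
      using a by (simp add: nat_pow_mult)
    finally show "x \<otimes> y \<in> {s \<otimes> a [^] n | s (n::nat). s \<in> S}"
      using S.m_closed[OF st] by blast
  qed
qed

text \<open>Adjoining an outside element to a maximal multiplicative set has to produce \<open>0\<close>.\<close>

lemma maximal_zero_free_submonoid_annihilator:
  assumes S: "maximal_zero_free_submonoid R S" and a: "a \<in> carrier R" "a \<notin> S"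
  obtains s and n :: nat where "s \<in> S" "s \<otimes> a [^] n = \<zero>"
proof -
  let ?T = "{s \<otimes> a [^] n | s (n::nat). s \<in> S}"
  have sub: "submonoid S R"
    using S by (simp add: maximal_zero_free_submonoid_def zero_free_submonoid_def)
  interpret S: submonoid S R by fact
  have "s \<in> ?T" if "s \<in> S" for s
    using that S.subset by (auto intro!: exI[of _ s] exI[of _ "0::nat"])
  moreover have "a \<in> ?T"
    using S.one_closed a by (auto intro!: exI[of _ \<one>] exI[of _ "1::nat"])
  ultimately have "S \<subseteq> ?T" "?T \<noteq> S"
    using a(2) by auto
  then have "\<zero> \<in> ?T"
    using S submonoid_adjoin_powers[OF sub a(1)]
    unfolding maximal_zero_free_submonoid_def zero_free_submonoid_def by blast
  then show ?thesis
    using that by auto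
qed

lemma zero_free_submonoid_complement_prime:
  assumes "primeideal P R"
  shows "zero_free_submonoid R (carrier R - P)"
proof -
  interpret P: primeideal P R by fact
  show ?thesis
    unfolding zero_free_submonoid_def
  proof
    show "submonoid (carrier R - P) R"
      using P.I_prime P.one_imp_carrier P.I_notcarr by unfold_locales auto
    show "\<zero> \<notin> carrier R - P"
      by simp
  qed
qed

text \<open>Closure of the complement under sums is the crux.  Powers of both summands are killed
  by elements of \<open>S\<close>, hence so is a power of their sum; if the sum were in \<open>S\<close>, then
  \<open>0\<close> would be as well.\<close>

lemma primeideal_complement_maximal:
  assumes S: "maximal_zero_free_submonoid R S"
  shows "primeideal (carrier R - S) R"
proof -
  have "submonoid S R" and zero: "\<zero> \<notin> S"
    using S by (simp_all add: maximal_zero_free_submonoid_def zero_free_submonoid_def)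
  then interpret S: submonoid S R by simp
  have S_pow: "x [^] n \<in> S" if "x \<in> S" for x and n :: nat
    by (induction n) (use that S.one_closed S.m_closed in auto)
  have add_closed: "a \<oplus> b \<notin> S"
    if a: "a \<in> carrier R" "a \<notin> S" and b: "b \<in> carrier R" "b \<notin> S" for a b
  proof
    assume sum: "a \<oplus> b \<in> S"
    obtain s and n :: nat where s: "s \<in> S" "s \<otimes> a [^] n = \<zero>"
      using maximal_zero_free_submonoid_annihilator[OF S a] .
    obtain t and m :: nat where t: "t \<in> S" "t \<otimes> b [^] m = \<zero>"
      using maximal_zero_free_submonoid_annihilator[OF S b] .
    have carr: "s \<in> carrier R" "t \<in> carrier R"
      using s t S.subset by auto
    have "(s \<otimes> t) \<otimes> a [^] n = t \<otimes> (s \<otimes> a [^] n)"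
      and "(s \<otimes> t) \<otimes> b [^] m = s \<otimes> (t \<otimes> b [^] m)"
      using a b carr by (simp_all add: m_ac)
    then have "(s \<otimes> t) \<otimes> (a \<oplus> b) [^] (n + m) = \<zero>"
      using s t a b carr by (intro annihilates_power_add) auto
    moreover have "(s \<otimes> t) \<otimes> (a \<oplus> b) [^] (n + m) \<in> S"
      using s t sum S_pow S.m_closed by simp
    ultimately show False
      using zero by simp
  qed
  have mult_closed: "x \<otimes> a \<notin> S"
    if a: "a \<in> carrier R" "a \<notin> S" and x: "x \<in> carrier R" for a x
  proof
    assume prod: "x \<otimes> a \<in> S"
    obtain s and n :: nat where s: "s \<in> S" "s \<otimes> a [^] n = \<zero>"
      using maximal_zero_free_submonoid_annihilator[OF S a] .
    have carr: "s \<in> carrier R"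
      using s S.subset by auto
    have "s \<otimes> (x \<otimes> a) [^] n = x [^] n \<otimes> (s \<otimes> a [^] n)"
      using a x carr by (simp add: nat_pow_distrib m_ac)
    then have "s \<otimes> (x \<otimes> a) [^] n = \<zero>"
      using s x by simp
    moreover have "s \<otimes> (x \<otimes> a) [^] n \<in> S"
      using s prod S_pow S.m_closed by simp
    ultimately show False
      using zero by simp
  qed
  have "\<ominus> a \<notin> S" if "a \<in> carrier R" "a \<notin> S" for a
    using mult_closed[OF that, of "\<ominus> \<one>"] that by (simp add: l_minus)
  then have "subgroup (carrier R - S) (add_monoid R)"
    using zero add_closed by (intro add.subgroupI) (auto simp flip: a_inv_def)
  then have "ideal (carrier R - S) R"
    using mult_closed by (intro idealI ring_axioms) (auto simp: m_comm)
  moreover have "carrier R \<noteq> carrier R - S"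
    using S.one_closed S.subset by blast
  ultimately show ?thesis
    using S.m_closed is_cring by (intro primeidealI) auto
qed

lemma minimal_prime_complement_maximal:
  assumes S: "maximal_zero_free_submonoid R S"
  shows "carrier R - S \<in> minimal_primes R"
proof -
  have sub: "S \<subseteq> carrier R"
    using S submonoid.subset
    unfolding maximal_zero_free_submonoid_def zero_free_submonoid_def by blast
  have "Q = carrier R - S" if Q: "primeideal Q R" "Q \<subseteq> carrier R - S" for Q
  proof -
    have "carrier R - Q = S"
      using S zero_free_submonoid_complement_prime[OF Q(1)] sub Q(2)
      unfolding maximal_zero_free_submonoid_def by blast
    then show ?thesis
      using Q(2) by blast
  qed
  then show ?thesis
    using primeideal_complement_maximal[OF S] by (simp add: minimal_primes_def)
qed

lemma zero_free_submonoid_Union_chain: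
  assumes chain: "subset.chain {T. zero_free_submonoid R T} C" and "C \<noteq> {}"
  shows "zero_free_submonoid R (\<Union>C)"
proof -
  have C: "submonoid T R" "\<zero> \<notin> T" if "T \<in> C" for T
    using chain that by (auto simp: subset.chain_def zero_free_submonoid_def)
  have "x \<otimes> y \<in> \<Union>C" if x: "x \<in> \<Union>C" and y: "y \<in> \<Union>C" for x y
  proof -
    obtain U V where UV: "U \<in> C" "x \<in> U" "V \<in> C" "y \<in> V"
      using x y by blast
    then have "U \<subseteq> V \<or> V \<subseteq> U"
      using chain by (auto simp: subset_chain_def)
    then show ?thesis
      using UV C(1) submonoid.m_closed by (metis UnionI subsetD)
  qed
  moreover have "\<one> \<in> \<Union>C"
    using \<open>C \<noteq> {}\<close> C(1) submonoid.one_closed by blast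
  moreover have "\<Union>C \<subseteq> carrier R"
    using C(1) submonoid.subset by blast
  ultimately have "submonoid (\<Union>C) R"
    by (intro submonoid.intro)
  then show ?thesis
    using C(2) by (auto simp: zero_free_submonoid_def)
qed

lemma zero_free_submonoid_extends_to_maximal:
  assumes "zero_free_submonoid R S"
  obtains M where "maximal_zero_free_submonoid R M" "S \<subseteq> M"
proof -
  let ?A = "{T. zero_free_submonoid R T \<and> S \<subseteq> T}"
  have "\<exists>M\<in>?A. \<forall>T\<in>?A. M \<subseteq> T \<longrightarrow> T = M"
  proof (rule subset_Zorn_nonempty)
    show "?A \<noteq> {}"
      using assms by blast
  next
    fix C assume C: "C \<noteq> {}" "subset.chain ?A C"
    then have "subset.chain {T. zero_free_submonoid R T} C"
      by (auto simp: subset.chain_def)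
    then have "zero_free_submonoid R (\<Union>C)"
      using C(1) by (rule zero_free_submonoid_Union_chain)
    moreover have "S \<subseteq> \<Union>C"
      using C unfolding subset.chain_def by blast
    ultimately show "\<Union>C \<in> ?A"
      by blast
  qed
  then obtain M where M: "M \<in> ?A" and max: "\<forall>T\<in>?A. M \<subseteq> T \<longrightarrow> T = M"
    by (elim bexE)
  have "T = M" if "zero_free_submonoid R T" "M \<subseteq> T" for T
    using M max that order_trans[of S M T] by simp
  then have "maximal_zero_free_submonoid R M"
    using M by (simp add: maximal_zero_free_submonoid_def)
  then show ?thesis
    using that M by simp
qed

text \<open>The complement of \<open>P\<close> is itself maximal: the complement of any maximal extension is a prime
  inside \<open>P\<close>, hence \<open>P\<close>.\<close>

lemma minimal_prime_annihilator:
  assumes P: "P \<in> minimal_primes R" and a: "a \<in> P"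
  obtains s and n :: nat where "s \<in> carrier R - P" "s \<otimes> a [^] n = \<zero>"
proof -
  have prime: "primeideal P R"
    using P by (simp add: minimal_primes_def)
  then have carr: "P \<subseteq> carrier R"
    by (meson ideal.Icarr primeideal.axioms(1) subsetI)
  obtain M where M: "maximal_zero_free_submonoid R M" "carrier R - P \<subseteq> M"
    using zero_free_submonoid_extends_to_maximal[OF zero_free_submonoid_complement_prime[OF prime]] .
  have "carrier R - M = P"
    using P M(2) primeideal_complement_maximal[OF M(1)] by (auto simp: minimal_primes_def)
  moreover have "M \<subseteq> carrier R"
    using M(1) submonoid.subset
    unfolding maximal_zero_free_submonoid_def zero_free_submonoid_def by blast
  ultimately have "M = carrier R - P"
    by blast
  then show ?thesis
    using maximal_zero_free_submonoid_annihilator[OF M(1), of a] that a carr by blast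
qed

text \<open>If no power of \<open>x\<close> vanishes, these powers extend to a maximal multiplicative set, whose
  complement is a minimal prime missing \<open>x\<close>.\<close>

lemma reduced_Inter_minimal_primes:
  assumes red: "reduced_ring R" and x: "x \<in> carrier R"
    and all: "\<And>P. P \<in> minimal_primes R \<Longrightarrow> x \<in> P"
  shows "x = \<zero>"
proof (rule ccontr)
  assume nz: "x \<noteq> \<zero>"
  let ?S = "{s \<otimes> x [^] n | s (n::nat). s \<in> {\<one>}}"
  have "submonoid {\<one>} R"
    by unfold_locales auto
  then have "submonoid ?S R"
    using x by (rule submonoid_adjoin_powers)
  moreover have "\<one> \<otimes> x [^] n \<noteq> \<zero>" for n :: nat
    using red x nz by (auto simp: reduced_ring_def)
  then have "\<zero> \<notin> ?S"
    by (simp only: mem_Collect_eq singleton_iff) metis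
  ultimately have "zero_free_submonoid R ?S"
    by (simp add: zero_free_submonoid_def)
  then obtain M where M: "maximal_zero_free_submonoid R M" "?S \<subseteq> M"
    by (rule zero_free_submonoid_extends_to_maximal)
  have "x \<in> ?S"
    using x by (auto intro!: exI[of _ "1::nat"])
  then show False
    using M(2) all[OF minimal_prime_complement_maximal[OF M(1)]] by blast
qed

text \<open>Take the least \<open>n\<close> with \<open>s a^n = 0\<close>.  It is positive because \<open>s \<noteq> 0\<close>, so
  \<open>s a^(n-1)\<close> is a nonzero element killed by \<open>a\<close>.\<close>

lemma zero_divisor_of_mem_minimal_prime:
  assumes P: "P \<in> minimal_primes R" and a: "a \<in> P"
  shows "zero_divisor R a"
proof -
  interpret P: primeideal P R
    using P by (simp add: minimal_primes_def)
  obtain s and n :: nat where s: "s \<in> carrier R - P" "s \<otimes> a [^] n = \<zero>"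
    using minimal_prime_annihilator[OF P a] .
  define m where "m = (LEAST m::nat. s \<otimes> a [^] m = \<zero>)"
  have m: "s \<otimes> a [^] m = \<zero>"
    unfolding m_def by (rule LeastI) (rule s(2))
  have ac: "a \<in> carrier R"
    using a by simp
  have "m \<noteq> 0"
  proof
    assume "m = 0"
    then have "s = \<zero>"
      using m s by simp
    then show False
      using s by simp
  qed
  then obtain k where k: "m = Suc k"
    by (metis not0_implies_Suc)
  have "s \<otimes> a [^] k \<noteq> \<zero>"
    using not_less_Least[of k "\<lambda>m. s \<otimes> a [^] m = \<zero>"] k by (auto simp: m_def)
  moreover have "a \<otimes> (s \<otimes> a [^] k) = \<zero>"
    using m k s ac by (simp add: m_ac)
  ultimately show ?thesis
    using s ac unfolding zero_divisor_def by (meson DiffD1 m_closed nat_pow_closed)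
qed

section \<open>The topology of the minimal spectrum\<close>

lemma openin_min_space_iff:
  "openin (min_space R) U \<longleftrightarrow> (\<forall>P\<in>U. \<exists>a\<in>carrier R. P \<in> min_D R a \<and> min_D R a \<subseteq> U)"
  unfolding openin_min_space arbitrary_union_of_alt by blast

lemma openin_min_D: "a \<in> carrier R \<Longrightarrow> openin (min_space R) (min_D R a)"
  unfolding openin_min_space_iff by blast

lemma min_D_zero: "min_D R \<zero> = {}"
proof -
  have "\<zero> \<in> P" if "P \<in> minimal_primes R" for P
  proof -
    interpret P: primeideal P R
      using that by (simp add: minimal_primes_def)
    show ?thesis by simp
  qed
  then show ?thesis
    by (auto simp: min_D_def)
qed

lemma min_D_one: "min_D R \<one> = minimal_primes R"
proof -
  have "\<one> \<notin> P" if "P \<in> minimal_primes R" for P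
  proof -
    interpret P: primeideal P R
      using that by (simp add: minimal_primes_def)
    show ?thesis
      using P.one_imp_carrier P.I_notcarr by blast
  qed
  then show ?thesis
    by (auto simp: min_D_def)
qed

lemma min_D_add_subset: "min_D R (a \<oplus> b) \<subseteq> min_D R a \<union> min_D R b"
proof
  fix P assume P: "P \<in> min_D R (a \<oplus> b)"
  then interpret P: primeideal P R
    by (simp add: min_D_def minimal_primes_def)
  show "P \<in> min_D R a \<union> min_D R b"
    using P P.a_closed by (auto simp: min_D_def)
qed

text \<open>A minimal prime containing \<open>a\<close> has the neighbourhood \<open>D(s)\<close>, where
  \<open>s a^n = 0\<close>; a prime missing both \<open>s\<close> and \<open>a\<close> would also miss
  \<open>s a^n = 0\<close>.\<close>

lemma closedin_min_D:
  assumes a: "a \<in> carrier R"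
  shows "closedin (min_space R) (min_D R a)"
proof -
  have "\<exists>s\<in>carrier R. P \<in> min_D R s \<and> min_D R s \<subseteq> minimal_primes R - min_D R a"
    if P: "P \<in> minimal_primes R - min_D R a" for P
  proof -
    have "P \<in> minimal_primes R" "a \<in> P"
      using P by (auto simp: min_D_def)
    then obtain s and n :: nat where s: "s \<in> carrier R - P" "s \<otimes> a [^] n = \<zero>"
      by (rule minimal_prime_annihilator)
    have "Q \<notin> min_D R a" if Q: "Q \<in> min_D R s" for Q
    proof
      assume "Q \<in> min_D R a"
      then have "primeideal Q R" and outside: "s \<in> carrier R - Q" "a \<in> carrier R - Q"
        using Q s a by (auto simp: min_D_def minimal_primes_def)
      then interpret C: submonoid "carrier R - Q" R
        using zero_free_submonoid_complement_prime by (simp add: zero_free_submonoid_def)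
      have "a [^] n \<in> carrier R - Q"
        by (induction n) (use outside C.one_closed C.m_closed in auto)
      then have "\<zero> \<in> carrier R - Q"
        using C.m_closed[OF outside(1)] s(2) by metis
      then show False
        using zero_free_submonoid_complement_prime[OF \<open>primeideal Q R\<close>]
        by (simp add: zero_free_submonoid_def)
    qed
    then show ?thesis
      using s P by (intro bexI[of _ s]) (auto simp: min_D_def)
  qed
  then show ?thesis
    unfolding closedin_def topspace_min_space openin_min_space_iff
    by (auto simp: min_D_def)
qed

lemma R_K_iff: "a \<in> R_K R \<longleftrightarrow> a \<in> carrier R \<and> compactin (min_space R) (min_D R a)"
  using closedin_min_D by (auto simp: R_K_def closure_of_closedin)

lemma R_K_downward:
  assumes "compactin (min_space R) K" "b \<in> carrier R" "min_D R b \<subseteq> K"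
  shows "b \<in> R_K R"
  using closed_compactin[OF assms(1,3) closedin_min_D] assms(2) by (simp add: R_K_iff)

lemma one_mem_R_K_iff: "\<one> \<in> R_K R \<longleftrightarrow> compact_space (min_space R)"
  by (simp add: R_K_iff min_D_one compact_space_def topspace_min_space)

text \<open>The compactness of \<open>D(a)\<close> and \<open>D(b)\<close> is inherited because
  \<open>D(a + b)\<close> and \<open>D(x a)\<close> are closed subsets of \<open>D(a) \<union> D(b)\<close> and \<open>D(a)\<close>.\<close>

lemma ideal_R_K: "ideal (R_K R) R"
proof -
  have add: "a \<oplus> b \<in> R_K R" if "a \<in> R_K R" "b \<in> R_K R" for a b
    using that compactin_Un[of "min_space R" "min_D R a" "min_D R b"]
    by (intro R_K_downward[OF _ _ min_D_add_subset]) (auto simp: R_K_iff)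
  have mult: "x \<otimes> a \<in> R_K R" if "a \<in> R_K R" "x \<in> carrier R" for a x
    using that by (intro R_K_downward[of "min_D R a"]) (auto simp: R_K_iff min_D_mult)
  have zero: "\<zero> \<in> R_K R"
    by (simp add: R_K_iff min_D_zero)
  have inv: "\<ominus> a \<in> R_K R" if a: "a \<in> R_K R" for a
  proof -
    have "a \<in> carrier R"
      using a by (simp add: R_K_iff)
    then show ?thesis
      using mult[OF a, of "\<ominus> \<one>"] by (simp add: l_minus)
  qed
  have "subgroup (R_K R) (add_monoid R)"
  proof (rule add.subgroupI)
    show "R_K R \<subseteq> carrier R"
      by (auto simp: R_K_def)
    show "R_K R \<noteq> {}"
      using zero by blast
  qed (fact inv add)+
  then show ?thesis
    using mult by (intro idealI ring_axioms) (auto simp: R_K_iff m_comm)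
qed

lemma locally_compact_min_space_iff:
  "locally_compact_space (min_space R) \<longleftrightarrow> (\<forall>P\<in>minimal_primes R. \<not> R_K R \<subseteq> P)"
proof
  assume loc: "locally_compact_space (min_space R)"
  show "\<forall>P\<in>minimal_primes R. \<not> R_K R \<subseteq> P"
  proof
    fix P assume "P \<in> minimal_primes R"
    then obtain U K where UK: "openin (min_space R) U" "compactin (min_space R) K" "P \<in> U" "U \<subseteq> K"
      using loc unfolding locally_compact_space_def topspace_min_space by blast
    then obtain a where a: "a \<in> carrier R" "P \<in> min_D R a" "min_D R a \<subseteq> U"
      unfolding openin_min_space_iff by blast
    then have "a \<in> R_K R"
      using UK by (intro R_K_downward[of K]) auto
    then show "\<not> R_K R \<subseteq> P"
      using a(2) by (auto simp: min_D_def)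
  qed
next
  assume *: "\<forall>P\<in>minimal_primes R. \<not> R_K R \<subseteq> P"
  show "locally_compact_space (min_space R)"
    unfolding locally_compact_space_def topspace_min_space
  proof
    fix P assume P: "P \<in> minimal_primes R"
    then obtain a where a: "a \<in> R_K R" "a \<notin> P"
      using * by blast
    then have "openin (min_space R) (min_D R a)" "compactin (min_space R) (min_D R a)"
      using openin_min_D by (simp_all add: R_K_iff)
    moreover have "P \<in> min_D R a"
      using P a(2) by (simp add: min_D_def)
    ultimately show "\<exists>U K. openin (min_space R) U \<and> compactin (min_space R) K \<and> P \<in> U \<and> U \<subseteq> K"
      by blast
  qed
qed

section \<open>Strong density\<close>

text \<open>Modulo every minimal prime missing \<open>a\<close>, some element of \<open>F\<close> is nonzero, so an
  annihilator \<open>c\<close> of \<open>F\<close> vanishes there; modulo the other minimal primes \<open>a\<close>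
  vanishes.  Thus \<open>c a\<close> is in all of them.\<close>

lemma reduced_ann_subset_if_min_D_covered:
  assumes red: "reduced_ring R" and a: "a \<in> carrier R" and F: "F \<subseteq> carrier R"
    and cover: "min_D R a \<subseteq> (\<Union>b\<in>F. min_D R b)"
  shows "ann R F \<subseteq> ann R {a}"
proof
  fix c assume c: "c \<in> ann R F"
  then have cc: "c \<in> carrier R"
    by (simp add: ann_def)
  have "c \<otimes> a \<in> P" if P: "P \<in> minimal_primes R" for P
  proof -
    interpret P: primeideal P R
      using P by (simp add: minimal_primes_def)
    show ?thesis
    proof (cases "a \<in> P")
      case True
      then show ?thesis
        using cc by (rule P.I_l_closed)
    next
      case False
      then have "P \<in> min_D R a"
        using P by (simp add: min_D_def)
      then obtain b where b: "b \<in> F" "b \<notin> P"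
        using cover by (auto simp: min_D_def)
      have "c \<otimes> b \<in> P"
        using c b(1) by (simp add: ann_def)
      then have "c \<in> P"
        using P.I_prime[OF cc] b F by blast
      then show ?thesis
        using a by (rule P.I_r_closed)
    qed
  qed
  then have "c \<otimes> a = \<zero>"
    using reduced_Inter_minimal_primes[OF red] cc a by simp
  then show "c \<in> ann R {a}"
    using cc by (simp add: ann_def)
qed

lemma reduced_R_K_subset:
  assumes red: "reduced_ring R" and sd: "sd_ideal R I" and fd: "fd_ideal R I"
  shows "R_K R \<subseteq> I"
proof
  fix a assume "a \<in> R_K R"
  then have a: "a \<in> carrier R" and comp: "compactin (min_space R) (min_D R a)"
    by (simp_all add: R_K_iff)
  have I: "I \<subseteq> carrier R"
    using sd by (meson ideal.Icarr sd_ideal_def subsetI)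
  have "min_D R a \<subseteq> \<Union>(min_D R ` I)"
    using sd by (auto simp: sd_ideal_def min_D_def)
  moreover have "openin (min_space R) U" if "U \<in> min_D R ` I" for U
    using that I openin_min_D by auto
  ultimately obtain \<F> where \<F>: "finite \<F>" "\<F> \<subseteq> min_D R ` I" "min_D R a \<subseteq> \<Union>\<F>"
    using compactinD[OF comp, of "min_D R ` I"] by blast
  obtain F where F: "finite F" "F \<subseteq> I" "\<F> = min_D R ` F"
    using finite_subset_image[OF \<F>(1,2)] by blast
  have "ann R F \<subseteq> ann R {a}"
    using red a F I \<F>(3) by (intro reduced_ann_subset_if_min_D_covered) auto
  then show "a \<in> I"
    using fd F a by (auto simp: fd_ideal_def)
qed

lemma R_K_zero_divisors_iff:
  "(\<forall>a\<in>R_K R. zero_divisor R a) \<longleftrightarrow> \<not> compact_space (min_space R)"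
proof
  assume "\<forall>a\<in>R_K R. zero_divisor R a"
  moreover have "\<not> zero_divisor R \<one>"
    by (auto simp: zero_divisor_def)
  ultimately show "\<not> compact_space (min_space R)"
    using one_mem_R_K_iff by blast
next
  assume ncomp: "\<not> compact_space (min_space R)"
  show "\<forall>a\<in>R_K R. zero_divisor R a"
  proof
    fix a assume "a \<in> R_K R"
    then have "min_D R a \<noteq> minimal_primes R"
      using ncomp by (auto simp: R_K_iff compact_space_def topspace_min_space)
    then obtain P where "P \<in> minimal_primes R" "a \<in> P"
      by (auto simp: min_D_def)
    then show "zero_divisor R a"
      by (rule zero_divisor_of_mem_minimal_prime)
  qed
qed

end

theorem proposition2p12:
  fixes R :: "('a, 'b) ring_scheme"
  assumes "cring R"
  shows "(reduced_ring R \<longrightarrow> R_K R \<subseteq> \<Inter>{I. sd_ideal R I \<and> fd_ideal R I}) \<and>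
    (sd_ideal R (R_K R) \<longleftrightarrow>
       locally_compact_space (min_space R) \<and> \<not> compact_space (min_space R))"
proof -
  interpret cring R by fact
  have "sd_ideal R (R_K R) \<longleftrightarrow>
      locally_compact_space (min_space R) \<and> \<not> compact_space (min_space R)"
    unfolding sd_ideal_def R_K_zero_divisors_iff locally_compact_min_space_iff
    using ideal_R_K by blast
  moreover have "R_K R \<subseteq> \<Inter>{I. sd_ideal R I \<and> fd_ideal R I}" if "reduced_ring R"
    using reduced_R_K_subset[OF that] by (intro Inter_greatest) simp
  ultimately show ?thesis
    by blast
qed

end
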